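(* Let $n\ge 2$ and let $\phi_1,\ldots,\phi_n:[0,1]\to(0,1)$ be Lipschitz contractions. Then for Lebesgue almost every $(x_1,\ldots,x_{n-1})\in\Omega_{n-1}$, the $n$-interval piecewise contraction $f=f_{\phi_1,\ldots,\phi_n,x_1,\ldots,x_{n-1}}:[0,1)\to[0,1)$ is asymptotically periodic and has at least one and at most $n$ periodic orbits.
   Context: A Lipschitz contraction is a Lipschitz map with Lipschitz constant strictly less than $1$. Let $I=[0,1)$ and $\Omega_{n-1}=\{(x_1,\ldots,x_{n-1})\in\mathbb{R}^{n-1}: 0<x_1<\cdots<x_{n-1}<1\}$. For $(x_1,\ldots,x_{n-1})\in\Omega_{n-1}$ put $x_0=0$, $x_n=1$; the map $f=f_{\phi_1,\ldots,\phi_n,x_1,\ldots,x_{n-1}}:I\to I$ is defined by $f(x)=\phi_i(x)$ for $x\in[x_{i-1},x_i)$, $1\le i\le n$. For $x\in I$, $\omega_f(x)=\bigcap_{m\ge0}\overline{\bigcup_{k\ge m}\{f^k(x)\}}$ is the $\omega$-limit set of $x$. A periodic orbit of $f$ is a finite set $O_f(p)=\{p,f(p),\ldots,f^{k-1}(p)\}$ where $p\in I$, $k\ge1$ and $f^k(p)=p$. The map $f$ is asymptotically periodic if $\omega_f(x)$ is a periodic orbit of $f$ for every $x\in I$. *)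

theory Defs
  imports "HOL-Analysis.Analysis"
begin

text \<open>Tuples \<open>(x\<^sub>1, \<dots>, x\<^sub>n\<^sub>-\<^sub>1)\<close> are functions \<open>nat \<Rightarrow> real\<close> that are extensional on the index
  set \<open>{1..<n}\<close>, i.e. points of the space of the product measure over \<open>{1..<n}\<close>.\<close>

definition lipschitz_contraction_on :: "real set \<Rightarrow> (real \<Rightarrow> real) \<Rightarrow> bool" where
  "lipschitz_contraction_on X g \<longleftrightarrow> (\<exists>L<1. L-lipschitz_on X g)"

text \<open>The conventions \<open>x\<^sub>0 = 0\<close> and \<open>x\<^sub>n = 1\<close>.\<close>

definition breakpoint :: "nat \<Rightarrow> (nat \<Rightarrow> real) \<Rightarrow> nat \<Rightarrow> real" where
  "breakpoint n x i = (if i = 0 then 0 else if i = n then 1 else x i)"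

definition Omega :: "nat \<Rightarrow> (nat \<Rightarrow> real) set" where
  "Omega n = {x \<in> {1..<n} \<rightarrow>\<^sub>E UNIV. \<forall>i\<in>{1..n}. breakpoint n x (i - 1) < breakpoint n x i}"

text \<open>All dynamical notions below only concern points of \<open>[0,1)\<close>; the value of \<open>pc_map\<close> elsewhere
  is irrelevant.\<close>

definition pc_map :: "nat \<Rightarrow> (nat \<Rightarrow> real \<Rightarrow> real) \<Rightarrow> (nat \<Rightarrow> real) \<Rightarrow> real \<Rightarrow> real" where
  "pc_map n \<phi> x t =
     \<phi> (THE i. i \<in> {1..n} \<and> t \<in> {breakpoint n x (i - 1)..<breakpoint n x i}) t"

lemma breakpoint_mono:
  assumes "x \<in> Omega n" "i \<le> j" "j \<le> n"
  shows "breakpoint n x i \<le> breakpoint n x j"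
  using assms(2,3)
proof (induction j rule: dec_induct)
  case (step k)
  then have "breakpoint n x (Suc k - 1) < breakpoint n x (Suc k)"
    using assms(1) unfolding Omega_def by force
  with step show ?case by simp
qed simp

lemma pc_map_eq:
  assumes "x \<in> Omega n" "i \<in> {1..n}" "t \<in> {breakpoint n x (i - 1)..<breakpoint n x i}"
  shows "pc_map n \<phi> x t = \<phi> i t"
proof -
  have "j = i" if j: "j \<in> {1..n}" "t \<in> {breakpoint n x (j - 1)..<breakpoint n x j}" for j
  proof (rule ccontr)
    assume "j \<noteq> i"
    then consider "i \<le> j - 1" | "j \<le> i - 1" by linarith
    then show False
    proof cases
      case 1
      then show False using breakpoint_mono[OF assms(1), of i "j - 1"] assms j by (simp add: le_diff_conv)
    next
      case 2
      then show False using breakpoint_mono[OF assms(1), of j "i - 1"] assms j by (simp add: le_diff_conv)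
    qed
  qed
  then have "(THE i. i \<in> {1..n} \<and> t \<in> {breakpoint n x (i - 1)..<breakpoint n x i}) = i"
    using assms by blast
  then show ?thesis by (simp add: pc_map_def)
qed

text \<open>The closure is taken in the real line. For the maps considered here this agrees with the
  closure in \<open>[0,1)\<close>, since all iterates after the initial point stay in a compact subset of
  \<open>(0,1)\<close>.\<close>

definition omega_limit :: "(real \<Rightarrow> real) \<Rightarrow> real \<Rightarrow> real set" where
  "omega_limit f x = (\<Inter>m. closure (\<Union>k\<in>{m..}. {(f ^^ k) x}))"

definition periodic_orbit :: "(real \<Rightarrow> real) \<Rightarrow> real set \<Rightarrow> bool" where
  "periodic_orbit f S \<longleftrightarrow>
     (\<exists>p\<in>{0..<1}. \<exists>k\<ge>1. (f ^^ k) p = p \<and> S = (\<lambda>j. (f ^^ j) p) ` {0..<k})"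

definition asymptotically_periodic :: "(real \<Rightarrow> real) \<Rightarrow> bool" where
  "asymptotically_periodic f \<longleftrightarrow> (\<forall>x\<in>{0..<1}. periodic_orbit f (omega_limit f x))"

end

theory Submission
  imports Defs
begin

text \<open>
  If the closure of some iterate \<open>f\<^sup>K([0,1))\<close> contains no breakpoint, then \<open>f\<close> contracts all
  sufficiently small distances on this compact invariant set, and every orbit converges to a periodic
  one.

  To see that almost every \<open>x\<close> has this property, call \<open>x\<close> generic if no nonempty composition of the
  branches maps a breakpoint to a breakpoint; the exceptions form a countable union of null sets. Fix
  a generic \<open>x\<^sub>0\<close> and \<open>N\<close> with \<open>2\<rho>\<^sup>N < 1\<close>. Near any point \<open>(x\<^sub>0, t)\<close>, the iterate \<open>f\<^sup>N\<close> agrees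
  pointwise with one of only two compositions of branches, because an orbit meets at most one
  breakpoint. By compactness the image of \<open>f\<^bsup>Nm+1\<^esup>\<close> is covered by \<open>M 2\<^sup>m\<close> balls of radius
  proportional to \<open>\<rho>\<^bsup>Nm\<^esup>\<close>, where the balls do not depend on \<open>x\<close> in a neighbourhood of \<open>x\<^sub>0\<close>. The
  intersection over \<open>m\<close> of these covers is a fixed null set, which almost every \<open>x\<close> near \<open>x\<^sub>0\<close>
  avoids; Lindelof's theorem makes this global.

  The bound on the number of periodic orbits holds for every \<open>x\<close>: the breakpoints are the edges of a
  connected graph on the orbits.
\<close>

section \<open>Orbits and limit sets\<close>

text \<open>A vertex set is grown from one vertex by adding an edge that leaves it together with the
  outer end of that edge; edges used earlier have both ends inside, so the edge is new.
  Connectedness enters as a crossing edge for every proper nonempty \<open>X\<close>; other edges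
  may have ends outside \<open>V\<close>.\<close>

lemma card_le_Suc_card_edges:
  fixes a b :: "'e \<Rightarrow> 'v"
  assumes "finite V" "finite E"
    and crossing: "\<And>X. X \<subset> V \<Longrightarrow> X \<noteq> {} \<Longrightarrow>
      \<exists>e\<in>E. a e \<in> V \<and> b e \<in> V \<and> (a e \<in> X) \<noteq> (b e \<in> X)"
  shows "card V \<le> Suc (card E)"
proof -
  have grow: "\<exists>X\<subseteq>V. \<exists>E'\<subseteq>E. card X = Suc k \<and> card E' = k \<and> (\<forall>e\<in>E'. a e \<in> X \<and> b e \<in> X)"
    if "Suc k \<le> card V" for k
    using that
  proof (induction k)
    case 0
    then obtain v where "v \<in> V" by fastforce
    then show ?case by (intro exI[of _ "{v}"] conjI exI[of _ "{}"]) auto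
  next
    case (Suc k)
    then obtain X E' where XE: "X \<subseteq> V" "E' \<subseteq> E" "card X = Suc k" "card E' = k"
        "\<forall>e\<in>E'. a e \<in> X \<and> b e \<in> X"
      by auto
    have "X \<noteq> V" "X \<noteq> {}" using XE Suc.prems by auto
    then obtain e where e: "e \<in> E" "a e \<in> V" "b e \<in> V" "(a e \<in> X) \<noteq> (b e \<in> X)"
      using crossing[of X] XE(1) by blast
    define v where "v = (if a e \<in> X then b e else a e)"
    have v: "v \<in> V" "v \<notin> X" using e by (auto simp: v_def)
    have "e \<notin> E'" using XE e by blast
    moreover have "finite X" "finite E'" using assms XE finite_subset by blast+
    ultimately show ?case
      using XE e v
      by (intro exI[of _ "insert v X"] conjI exI[of _ "insert e E'"]) (auto simp: v_def)
  qed
  show ?thesis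
  proof (cases "card V")
    case (Suc k)
    then obtain E' where "E' \<subseteq> E" "card E' = k" using grow[of k] by auto
    then show ?thesis using Suc card_mono[OF assms(2)] by auto
  qed simp
qed

section \<open>Periodic orbits as sets\<close>

lemma funpow_mult_period:
  assumes "(f ^^ p) q = q"
  shows "(f ^^ (p * m)) q = q"
  by (induction m) (simp_all add: funpow_add assms)

lemma funpow_mod_period:
  assumes "(f ^^ p) q = q"
  shows "(f ^^ j) q = (f ^^ (j mod p)) q"
proof -
  have "(f ^^ j) q = (f ^^ (j mod p + p * (j div p))) q" by simp
  also have "\<dots> = (f ^^ (j mod p)) ((f ^^ (p * (j div p))) q)" by (simp only: funpow_add o_apply)
  finally show ?thesis by (simp add: funpow_mult_period[OF assms])
qed

lemma image_orbit_eq_range: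
  assumes "p \<ge> 1" "(f ^^ p) q = q"
  shows "(\<lambda>j. (f ^^ j) q) ` {0..<p} = range (\<lambda>j. (f ^^ j) q)"
proof -
  have "(f ^^ j) q \<in> (\<lambda>j. (f ^^ j) q) ` {0..<p}" for j
    using funpow_mod_period[OF assms(2), of j] assms(1) by (intro image_eqI[of _ _ "j mod p"]) auto
  then show ?thesis by blast
qed

text \<open>A cycle may be started at any of its points, hence two periodic orbits that meet
  coincide.\<close>

lemma periodic_orbit_eq_range:
  assumes "periodic_orbit f S" "r \<in> S"
  shows "S = range (\<lambda>j. (f ^^ j) r)"
proof -
  obtain p k where pk: "k \<ge> 1" "(f ^^ k) p = p" "S = (\<lambda>j. (f ^^ j) p) ` {0..<k}"
    using assms by (auto simp: periodic_orbit_def)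
  then obtain i where i: "r = (f ^^ i) p" "i < k" using assms by auto
  have S: "S = range (\<lambda>j. (f ^^ j) p)" using image_orbit_eq_range[OF pk(1,2)] pk(3) by simp
  have "(f ^^ j) r = (f ^^ (j + i)) p" for j by (simp add: i funpow_add)
  moreover have "(f ^^ j) p = (f ^^ (j + (k - i))) r" for j
  proof -
    have "(f ^^ (j + (k - i))) r = (f ^^ (j + (k - i) + i)) p" unfolding i by (simp add: funpow_add)
    also have "\<dots> = (f ^^ (j + k)) p" using i by simp
    finally show ?thesis by (simp add: funpow_add pk)
  qed
  ultimately show ?thesis unfolding S by (auto simp: image_def)
qed

lemma periodic_orbit_closed:
  assumes "periodic_orbit f S" "r \<in> S"
  shows "f r \<in> S"
proof -
  have "f r = (f ^^ 1) r" by simp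
  then show ?thesis using periodic_orbit_eq_range[OF assms] by blast
qed

lemma periodic_orbits_eq_if_meet:
  assumes "periodic_orbit f S" "periodic_orbit f T" "r \<in> S" "r \<in> T"
  shows "S = T"
  using periodic_orbit_eq_range assms by metis

lemma finite_periodic_orbit: "periodic_orbit f S \<Longrightarrow> finite S"
  by (auto simp: periodic_orbit_def)

lemma nonempty_periodic_orbit: "periodic_orbit f S \<Longrightarrow> S \<noteq> {}"
  by (auto simp: periodic_orbit_def)

lemma funpow_in_unit_interval:
  fixes f :: "real \<Rightarrow> real"
  assumes "\<And>t. t \<in> {0..<1} \<Longrightarrow> f t \<in> {0..<1}" "t \<in> {0..<1}"
  shows "(f ^^ j) t \<in> {0..<1}"
  by (induction j) (use assms in auto)

lemma periodic_orbit_subset: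
  assumes "\<And>t. t \<in> {0..<1} \<Longrightarrow> f t \<in> {0..<1}" "periodic_orbit f S"
  shows "S \<subseteq> {0..<1}"
  using assms(2) funpow_in_unit_interval[OF assms(1)] by (fastforce simp: periodic_orbit_def)

lemma funpow_cong_unit_interval:
  fixes f g :: "real \<Rightarrow> real"
  assumes "\<And>t. t \<in> {0..<1} \<Longrightarrow> f t = g t" "\<And>t. t \<in> {0..<1} \<Longrightarrow> g t \<in> {0..<1}" "t \<in> {0..<1}"
  shows "(f ^^ j) t = (g ^^ j) t"
proof (induction j)
  case (Suc j)
  then show ?case using assms(1) funpow_in_unit_interval[of g t j, OF assms(2,3)] by simp
qed simp

text \<open>The tail of the orbit shadows the cycle, so along each residue class modulo
  \<open>p\<close> it converges to one cycle point. Any other point has positive distance from the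
  finite cycle and is no limit point.\<close>

lemma omega_limit_eq_orbit:
  fixes f :: "real \<Rightarrow> real"
  assumes p: "p \<ge> 1" "(f ^^ p) q = q"
    and lim: "(\<lambda>j. (f ^^ (a + j)) t - (f ^^ j) q) \<longlonglongrightarrow> 0"
  shows "omega_limit f t = (\<lambda>j. (f ^^ j) q) ` {0..<p}"
proof
  show "(\<lambda>j. (f ^^ j) q) ` {0..<p} \<subseteq> omega_limit f t"
  proof
    fix y assume "y \<in> (\<lambda>j. (f ^^ j) q) ` {0..<p}"
    then obtain i where y: "y = (f ^^ i) q" by auto
    have "strict_mono (\<lambda>k. i + p * k)" using p by (auto simp: strict_mono_def)
    from LIMSEQ_subseq_LIMSEQ[OF lim this]
    have "(\<lambda>k. (f ^^ (a + (i + p * k))) t - (f ^^ (i + p * k)) q) \<longlonglongrightarrow> 0" by (simp add: o_def)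
    moreover have "(f ^^ (i + p * k)) q = y" for k
      using funpow_mult_period[OF p(2), of k] by (simp add: funpow_add y)
    ultimately have l: "(\<lambda>k. (f ^^ (a + (i + p * k))) t) \<longlonglongrightarrow> y" by (simp add: LIM_zero_iff)
    have "y \<in> closure (\<Union>k\<in>{m..}. {(f ^^ k) t})" for m
    proof (rule Lim_in_closed_set[OF closed_closure _ _ l])
      have "(f ^^ (a + (i + p * k))) t \<in> (\<Union>k\<in>{m..}. {(f ^^ k) t})" if "k \<ge> m" for k
      proof -
        have "1 * m \<le> p * k" using that p by (intro mult_mono) auto
        then have "a + (i + p * k) \<in> {m..}" by simp
        then show ?thesis by blast
      qed
      then show "\<forall>\<^sub>F k in sequentially. (f ^^ (a + (i + p * k))) t \<in> closure (\<Union>k\<in>{m..}. {(f ^^ k) t})"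
        using closure_subset by (intro eventually_sequentiallyI[of m]) blast
    qed simp
    then show "y \<in> omega_limit f t" by (simp add: omega_limit_def)
  qed
  show "omega_limit f t \<subseteq> (\<lambda>j. (f ^^ j) q) ` {0..<p}"
  proof (rule subsetI, rule ccontr)
    let ?O = "(\<lambda>j. (f ^^ j) q) ` {0..<p}"
    fix y assume y: "y \<in> omega_limit f t" "y \<notin> ?O"
    have "closed ?O" by (simp add: finite_imp_closed)
    then obtain e where e: "e > 0" "\<And>z. z \<in> ?O \<Longrightarrow> e \<le> dist y z"
      using separate_point_closed[of ?O y] y by blast
    obtain J where J: "\<And>j. j \<ge> J \<Longrightarrow> \<bar>(f ^^ (a + j)) t - (f ^^ j) q\<bar> < e / 2"
      using LIMSEQ_D[OF lim, of "e / 2"] e by auto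
    have "y \<in> closure (\<Union>k\<in>{a + J..}. {(f ^^ k) t})"
      using y by (simp only: omega_limit_def INT_iff) blast
    then obtain k where k: "k \<ge> a + J" "dist ((f ^^ k) t) y < e / 2"
      using e by (fastforce simp: closure_approachable dest!: spec[of _ "e / 2"])
    have "\<bar>(f ^^ k) t - (f ^^ (k - a)) q\<bar> < e / 2" using J[of "k - a"] k by simp
    moreover have "e \<le> dist y ((f ^^ (k - a)) q)"
      using e(2) image_orbit_eq_range[OF p] by blast
    ultimately show False using k unfolding dist_real_def by linarith
  qed
qed

text \<open>Two nearby points never move apart, so the closeness required by \<open>contr\<close>
  survives each step.\<close>

lemma funpow_locally_contracting:
  fixes f :: "real \<Rightarrow> real"
  assumes "f ` A \<subseteq> A" "0 \<le> \<rho>" "\<rho> < 1"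
    and contr: "\<And>s t. s \<in> A \<Longrightarrow> t \<in> A \<Longrightarrow> \<bar>s - t\<bar> < \<epsilon> \<Longrightarrow> \<bar>f s - f t\<bar> \<le> \<rho> * \<bar>s - t\<bar>"
    and st: "s \<in> A" "t \<in> A" "\<bar>s - t\<bar> < \<epsilon>"
  shows "(f ^^ j) s \<in> A \<and> (f ^^ j) t \<in> A \<and> \<bar>(f ^^ j) s - (f ^^ j) t\<bar> \<le> \<rho> ^ j * \<bar>s - t\<bar>"
proof (induction j)
  case (Suc j)
  have "\<rho> ^ j * \<bar>s - t\<bar> \<le> 1 * \<bar>s - t\<bar>"
    using assms by (intro mult_right_mono power_le_one) auto
  then have "\<bar>f ((f ^^ j) s) - f ((f ^^ j) t)\<bar> \<le> \<rho> * \<bar>(f ^^ j) s - (f ^^ j) t\<bar>"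
    using Suc st by (intro contr) auto
  also have "\<dots> \<le> \<rho> * (\<rho> ^ j * \<bar>s - t\<bar>)" using Suc assms(2) by (intro mult_left_mono) auto
  finally show ?case using Suc assms(1) by auto
qed (use st in auto)

text \<open>By compactness the orbit nearly returns: two of its points, \<open>p\<close> steps
  apart, are closer than \<epsilon>. Iterating \<open>f ^^ p\<close> from the first one then gives
  geometrically small steps and a limit point \<open>q\<close> fixed by \<open>f ^^ p\<close>; the
  orbit of \<open>t\<close> shadows the cycle of \<open>q\<close>.\<close>

lemma omega_limit_locally_contracting:
  fixes f :: "real \<Rightarrow> real"
  assumes "compact A" "f ` A \<subseteq> A" "0 \<le> \<rho>" "\<rho> < 1" "\<epsilon> > 0"
    and contr: "\<And>s t. s \<in> A \<Longrightarrow> t \<in> A \<Longrightarrow> \<bar>s - t\<bar> < \<epsilon> \<Longrightarrow> \<bar>f s - f t\<bar> \<le> \<rho> * \<bar>s - t\<bar>"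
    and t: "(f ^^ K) t \<in> A"
  shows "\<exists>q\<in>A. \<exists>p\<ge>1. (f ^^ p) q = q \<and> omega_limit f t = (\<lambda>j. (f ^^ j) q) ` {0..<p}"
proof -
  have local: "(f ^^ j) s \<in> A \<and> (f ^^ j) t \<in> A \<and> \<bar>(f ^^ j) s - (f ^^ j) t\<bar> \<le> \<rho> ^ j * \<bar>s - t\<bar>"
    if "s \<in> A" "t \<in> A" "\<bar>s - t\<bar> < \<epsilon>" for s t j
    using assms(2-4) contr that by (rule funpow_locally_contracting)
  have inA: "(f ^^ j) s \<in> A" if "s \<in> A" for s j using local[OF that that, of j] assms(5) by simp
  define y where "y k = (f ^^ (k + K)) t" for k
  have yA: "y k \<in> A" for k using inA[OF t, of k] by (simp add: y_def funpow_add)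
  obtain l r where r: "strict_mono r" "(y \<circ> r) \<longlonglongrightarrow> l"
    using assms(1) yA unfolding compact_def by metis
  from r(2) have "Cauchy (y \<circ> r)" by (rule LIMSEQ_imp_Cauchy)
  then obtain M where M: "\<And>i j. i \<ge> M \<Longrightarrow> j \<ge> M \<Longrightarrow> dist (y (r i)) (y (r j)) < \<epsilon>"
    using metric_CauchyD[of "y \<circ> r" \<epsilon>] assms(5) by auto
  define p where "p = r (Suc M) - r M"
  have rM: "r M < r (Suc M)" using r(1) by (simp add: strict_mono_def)
  then have p: "p \<ge> 1" by (simp add: p_def)
  define s where "s = y (r M)"
  define u where "u j = (f ^^ (p * j)) s" for j
  have s: "s \<in> A" using yA by (simp add: s_def)
  have uA: "u j \<in> A" for j using inA[OF s] by (simp add: u_def)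
  have step: "u (Suc j) = (f ^^ p) (u j)" for j by (simp add: u_def funpow_add)
  have "r M + p = r (Suc M)" using rM by (simp add: p_def)
  then have "(f ^^ p) s = y (r (Suc M))" by (metis s_def y_def add.commute add.assoc funpow_add o_apply)
  then have close: "\<bar>(f ^^ p) s - s\<bar> < \<epsilon>" using M[of "Suc M" M] by (simp add: s_def dist_real_def)
  have "\<bar>u (Suc j) - u j\<bar> \<le> \<rho> ^ (p * j) * \<bar>(f ^^ p) s - s\<bar>" for j
  proof -
    have "u (Suc j) = (f ^^ (p * j)) ((f ^^ p) s)"
      by (simp add: u_def funpow_add[symmetric] add.commute flip: o_apply[of "f ^^ _"])
    then show ?thesis using local[OF inA[OF s] s close, of "p * j"] by (simp add: u_def)
  qed
  then have bound: "\<bar>u (Suc j) - u j\<bar> \<le> \<rho> ^ j * \<epsilon>" for j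
  proof -
    have "\<rho> ^ (p * j) \<le> \<rho> ^ j" using p assms(3,4) by (intro power_decreasing) auto
    then have "\<rho> ^ (p * j) * \<bar>(f ^^ p) s - s\<bar> \<le> \<rho> ^ j * \<epsilon>"
      using close assms by (intro mult_mono) auto
    then show ?thesis using \<open>\<bar>u (Suc j) - u j\<bar> \<le> \<rho> ^ (p * j) * \<bar>(f ^^ p) s - s\<bar>\<close> by linarith
  qed
  \<comment> \<open>A subsequential limit suffices: consecutive terms of \<open>u\<close> approach
    each other, so the shifted subsequence also tends to \<open>q\<close>, while by local
    contraction it tends to \<open>(f ^^ p) q\<close>.\<close>
  obtain q r' where q: "q \<in> A" and r': "strict_mono r'" "(u \<circ> r') \<longlonglongrightarrow> q"
    using assms(1) uA unfolding compact_def by metis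
  have powers: "(\<lambda>j. \<rho> ^ j * c) \<longlonglongrightarrow> 0" for c
    using tendsto_mult_right[OF LIMSEQ_realpow_zero[OF assms(3,4)], of c] by simp
  have diff: "(\<lambda>j. u (Suc j) - u j) \<longlonglongrightarrow> 0"
    by (rule Lim_null_comparison[OF _ powers[of \<epsilon>]]) (use bound in auto)
  have near: "\<forall>\<^sub>F k in sequentially. \<bar>u (r' k) - q\<bar> < \<epsilon>"
    using tendstoD[OF r'(2) assms(5)] by (simp add: dist_real_def)
  have "(\<lambda>k. (f ^^ p) (u (r' k)) - (f ^^ p) q) \<longlonglongrightarrow> 0"
  proof (rule Lim_null_comparison)
    show "(\<lambda>k. \<rho> ^ p * \<bar>u (r' k) - q\<bar>) \<longlonglongrightarrow> 0"
      using r'(2) by (auto intro!: tendsto_mult_right_zero tendsto_rabs_zero simp: LIM_zero_iff o_def)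
    show "\<forall>\<^sub>F k in sequentially. norm ((f ^^ p) (u (r' k)) - (f ^^ p) q) \<le> \<rho> ^ p * \<bar>u (r' k) - q\<bar>"
      using near by eventually_elim (use local[OF uA q] in auto)
  qed
  then have "(\<lambda>k. u (Suc (r' k))) \<longlonglongrightarrow> (f ^^ p) q" by (simp add: LIM_zero_iff step)
  moreover have "(\<lambda>k. u (Suc (r' k))) \<longlonglongrightarrow> q"
    using tendsto_add[OF LIMSEQ_subseq_LIMSEQ[OF diff r'(1)] r'(2)] by (simp add: o_def)
  ultimately have per: "(f ^^ p) q = q" using LIMSEQ_unique by blast
  obtain k where k: "\<bar>u (r' k) - q\<bar> < \<epsilon>" using near eventually_happens trivial_limit_sequentially by blast
  \<comment> \<open>Time needed to reach \<open>u (r' k)\<close>: \<open>K\<close> steps into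
    \<open>A\<close>, \<open>r M\<close> more to \<open>s\<close>, then \<open>r' k\<close> blocks
    of \<open>p\<close> steps.\<close>
  define a where "a = p * r' k + (r M + K)"
  have "(f ^^ (a + j)) t = (f ^^ j) (u (r' k))" for j
    by (simp add: a_def u_def s_def y_def funpow_add add.commute[of _ j])
  moreover have "(\<lambda>j. (f ^^ j) (u (r' k)) - (f ^^ j) q) \<longlonglongrightarrow> 0"
    by (rule Lim_null_comparison[OF _ powers[of "\<bar>u (r' k) - q\<bar>"]]) (use local[OF uA q k] in auto)
  ultimately have "(\<lambda>j. (f ^^ (a + j)) t - (f ^^ j) q) \<longlonglongrightarrow> 0" by simp
  from omega_limit_eq_orbit[OF p per this] show ?thesis using q p per by blast
qed

section \<open>Piecewise contractions\<close>

text \<open>One contraction constant and one compact interval inside (0,1) serve all branches. The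
  branches live on the whole line, so that neighbourhoods and compositions need no side conditions
  on arguments.\<close>

locale contraction_family =
  fixes n :: nat and \<phi> :: "nat \<Rightarrow> real \<Rightarrow> real" and \<rho> \<alpha> \<beta> :: real
  assumes n_pos: "n \<ge> 1"
    and rho: "0 \<le> \<rho>" "\<rho> < 1"
    and bounds: "0 < \<alpha>" "\<beta> < 1"
    and lipschitz: "i \<in> {1..n} \<Longrightarrow> \<bar>\<phi> i s - \<phi> i t\<bar> \<le> \<rho> * \<bar>s - t\<bar>"
    and range: "i \<in> {1..n} \<Longrightarrow> \<phi> i t \<in> {\<alpha>..\<beta>}"
begin

abbreviation F :: "(nat \<Rightarrow> real) \<Rightarrow> real \<Rightarrow> real" where
  "F x \<equiv> pc_map n \<phi> x"

abbreviation I :: "real set" where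
  "I \<equiv> {0..<1}"

lemma interval_subset: "{\<alpha>..\<beta>} \<subseteq> I"
  using bounds by auto

section \<open>Dynamics for fixed breakpoints\<close>

lemma piece_exists:
  assumes "t \<in> I"
  obtains i where "i \<in> {1..n}" "t \<in> {breakpoint n x (i - 1)..<breakpoint n x i}"
proof -
  define i where "i = (LEAST i. t < breakpoint n x i)"
  have n: "t < breakpoint n x n" using assms n_pos by (auto simp: breakpoint_def)
  then have i: "t < breakpoint n x i" unfolding i_def by (rule LeastI)
  have "i \<le> n" unfolding i_def using n by (rule Least_le)
  moreover have "i \<noteq> 0" using i assms by (intro notI) (simp add: breakpoint_def)
  moreover from this have "\<not> t < breakpoint n x (i - 1)"
    unfolding i_def by (intro not_less_Least) simp
  ultimately show ?thesis using i by (intro that[of i]) auto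
qed

lemma F_range:
  assumes "x \<in> Omega n" "t \<in> I"
  shows "F x t \<in> {\<alpha>..\<beta>}"
  using piece_exists[OF assms(2)] pc_map_eq[OF assms(1)] range by metis

lemma F_in_unit_interval: "x \<in> Omega n \<Longrightarrow> t \<in> I \<Longrightarrow> F x t \<in> I"
  using F_range interval_subset by blast

lemma F_contracts_on_piece:
  assumes "x \<in> Omega n" "i \<in> {1..n}"
    and "s \<in> {breakpoint n x (i - 1)..<breakpoint n x i}"
    and "t \<in> {breakpoint n x (i - 1)..<breakpoint n x i}"
  shows "\<bar>F x s - F x t\<bar> \<le> \<rho> * \<bar>s - t\<bar>"
  using lipschitz assms by (simp add: pc_map_eq)

text \<open>A closest pair of periodic points from two families of orbits cannot lie in one piece, since
  \<open>F\<close> would move it closer; so each splitting of the orbits is witnessed by a breakpoint whose two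
  neighbouring periodic points are on different sides of it. Joining the orbits of these two points
  by an edge gives a connected graph.\<close>

lemma card_periodic_orbits_le:
  assumes x: "x \<in> Omega n" and fin: "finite \<S>" and orb: "\<And>S. S \<in> \<S> \<Longrightarrow> periodic_orbit (F x) S"
  shows "card \<S> \<le> n"
proof -
  define cls where "cls r = (THE S. S \<in> \<S> \<and> r \<in> S)" for r
  have cls: "cls r = S" if "S \<in> \<S>" "r \<in> S" for r S
    unfolding cls_def using that orb periodic_orbits_eq_if_meet by (intro the_equality) blast+
  have finQ: "finite (\<Union>\<X>)" if "\<X> \<subseteq> \<S>" for \<X>
  proof (rule finite_Union)
    show "finite \<X>" using that fin finite_subset by blast
  qed (use that orb finite_periodic_orbit in blast)
  have QI: "\<Union>\<S> \<subseteq> I" using periodic_orbit_subset[of "F x", OF F_in_unit_interval[OF x]] orb by blast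
  have inv: "F x r \<in> \<Union>\<X>" if "\<X> \<subseteq> \<S>" "r \<in> \<Union>\<X>" for \<X> r
    using that orb periodic_orbit_closed by blast
  \<comment> \<open>The edge at \<open>d\<close> joins the orbits of the last periodic point below
    \<open>x d\<close> and of the first one at or above it, as pieces are closed on the left.
    \<open>Max\<close> or \<open>Min\<close> of an empty set is harmless, since only a crossing edge
    must have its ends in \<open>\<S>\<close>.\<close>
  let ?a = "\<lambda>d. cls (Max {q \<in> \<Union>\<S>. q < x d})" and ?b = "\<lambda>d. cls (Min {q \<in> \<Union>\<S>. x d \<le> q})"
  have "card \<S> \<le> Suc (card {1..<n})"
  proof (rule card_le_Suc_card_edges[where a = ?a and b = ?b])
    fix \<X> assume X: "\<X> \<subset> \<S>" "\<X> \<noteq> {}"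
    define P where "P = (\<Union>\<X>) \<times> (\<Union>(\<S> - \<X>))"
    have ne: "\<Union>\<X> \<noteq> {}" if "\<X> \<subseteq> \<S>" "\<X> \<noteq> {}" for \<X>
      using that orb nonempty_periodic_orbit by blast
    have "\<Union>\<X> \<noteq> {}" "\<Union>(\<S> - \<X>) \<noteq> {}"
      using X by (intro ne; blast)+
    then have "P \<noteq> {}" unfolding P_def by blast
    moreover have "finite P" unfolding P_def using X by (intro finite_cartesian_product finQ) auto
    ultimately obtain z where z: "z \<in> P"
        "\<And>z'. z' \<in> P \<Longrightarrow> \<bar>fst z - snd z\<bar> \<le> \<bar>fst z' - snd z'\<bar>"
      using arg_min_if_finite[of P "\<lambda>z. \<bar>fst z - snd z\<bar>"] 
      by (meson linorder_not_less)
    obtain q q' where qq': "z = (q, q')" by (cases z)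
    have q: "q \<in> \<Union>\<X>" "q' \<in> \<Union>(\<S> - \<X>)" using z(1) by (auto simp: P_def qq')
    have closest: "\<bar>q - q'\<bar> \<le> \<bar>r - r'\<bar>" if "r \<in> \<Union>\<X>" "r' \<in> \<Union>(\<S> - \<X>)" for r r'
      using z(2)[of "(r, r')"] that by (simp add: P_def qq')
    have disj: "cls r \<in> \<X> \<longleftrightarrow> r \<in> \<Union>\<X>" "cls r \<in> \<S>" if "r \<in> \<Union>\<S>" for r
      using that cls X by (metis UnionE UnionI psubsetD)+
    have "q \<noteq> q'" using q cls X by (metis DiffE UnionE psubsetD)
    define u v where "u = min q q'" and "v = max q q'"
    have uv: "u < v" "v - u = \<bar>q - q'\<bar>" using \<open>q \<noteq> q'\<close> by (auto simp: u_def v_def)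
    have uvQ: "u \<in> \<Union>\<S>" "v \<in> \<Union>\<S>" using q X by (auto simp: u_def v_def min_def max_def)
    have cross: "(u \<in> \<Union>\<X>) \<noteq> (v \<in> \<Union>\<X>)"
    proof -
      have "q' \<notin> \<Union>\<X>" using q cls X by (metis DiffE UnionE psubsetD)
      then show ?thesis using q \<open>q \<noteq> q'\<close> by (auto simp: u_def v_def min_def max_def)
    qed
    have split: "r \<in> \<Union>\<X> \<or> r \<in> \<Union>(\<S> - \<X>)" if "r \<in> \<Union>\<S>" for r using that by blast
    \<comment> \<open>A periodic point strictly between would be closer to whichever of
      \<open>q\<close> and \<open>q'\<close> belongs to the other family.\<close>
    have between: "r \<le> u \<or> v \<le> r" if r: "r \<in> \<Union>\<S>" for r
    proof (rule ccontr)
      assume "\<not> (r \<le> u \<or> v \<le> r)"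
      then have "\<bar>r - q'\<bar> < \<bar>q - q'\<bar>" "\<bar>q - r\<bar> < \<bar>q - q'\<bar>" unfolding u_def v_def by linarith+
      then show False using split[OF r] closest[OF q(1), of r] closest[OF _ q(2), of r] by linarith
    qed
    have "u \<in> I" using QI uvQ(1) by (rule subsetD)
    then obtain i where i: "i \<in> {1..n}" "u \<in> {breakpoint n x (i - 1)..<breakpoint n x i}"
      by (rule piece_exists)
    have v: "breakpoint n x i \<le> v"
    proof (rule ccontr)
      assume "\<not> breakpoint n x i \<le> v"
      then have "v \<in> {breakpoint n x (i - 1)..<breakpoint n x i}" using i uv by auto
      then have "q \<in> {breakpoint n x (i - 1)..<breakpoint n x i}"
          "q' \<in> {breakpoint n x (i - 1)..<breakpoint n x i}"
        using i(2) by (auto simp: u_def v_def min_def max_def split: if_splits)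
      then have "\<bar>F x q - F x q'\<bar> \<le> \<rho> * \<bar>q - q'\<bar>" by (rule F_contracts_on_piece[OF x i(1)])
      also have "\<dots> < 1 * \<bar>q - q'\<bar>" using rho \<open>q \<noteq> q'\<close> by (intro mult_strict_right_mono) auto
      finally show False using closest[of "F x q" "F x q'"] inv[of \<X> q] inv[of "\<S> - \<X>" q'] q X by auto
    qed
    \<comment> \<open>As \<open>v\<close> is below 1, the piece of \<open>u\<close> is not the last
      one, and its right end is a genuine coordinate of \<open>x\<close>.\<close>
    have "v < 1" using uvQ QI by auto
    then have "i \<noteq> n" using v n_pos by (auto simp: breakpoint_def)
    then have d: "i \<in> {1..<n}" and xi: "breakpoint n x i = x i" using i by (auto simp: breakpoint_def)
    have ui: "u < x i" "x i \<le> v" using i xi v by auto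
    have "Max {q \<in> \<Union>\<S>. q < x i} = u"
    proof (rule Max_eqI)
      show "r \<le> u" if "r \<in> {q \<in> \<Union>\<S>. q < x i}" for r using that between[of r] ui by force
      show "finite {q \<in> \<Union>\<S>. q < x i}" by (rule finite_subset[OF _ finQ[OF order_refl]]) blast
    qed (use ui uvQ in simp)
    moreover have "Min {q \<in> \<Union>\<S>. x i \<le> q} = v"
    proof (rule Min_eqI)
      show "v \<le> r" if "r \<in> {q \<in> \<Union>\<S>. x i \<le> q}" for r using that between[of r] ui by force
      show "finite {q \<in> \<Union>\<S>. x i \<le> q}" by (rule finite_subset[OF _ finQ[OF order_refl]]) blast
    qed (use ui uvQ in simp)
    ultimately show "\<exists>e\<in>{1..<n}. ?a e \<in> \<S> \<and> ?b e \<in> \<S> \<and> (?a e \<in> \<X>) \<noteq> (?b e \<in> \<X>)"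
      using d disj uvQ cross by (intro bexI[of _ i]) auto
  qed (use fin in auto)
  then show ?thesis using n_pos by simp
qed

text \<open>The iterated images of \<open>I\<close> decrease, so one \<open>K\<close> serves all
  breakpoints. The closure \<open>A\<close> of that image has positive distance from them; points of
  \<open>A\<close> closer than this distance lie in one piece, where the map contracts.\<close>

lemma asymptotically_periodic_if_avoiding:
  assumes x: "x \<in> Omega n"
    and avoid: "\<And>i. i \<in> {1..<n} \<Longrightarrow> \<exists>K. x i \<notin> closure ((F x ^^ K) ` I)"
  shows "asymptotically_periodic (F x)"
proof -
  have FI: "(F x ^^ K) ` I \<subseteq> I" for K
    using funpow_in_unit_interval[of "F x", OF F_in_unit_interval[OF x]] by blast
  have antimono: "(F x ^^ L) ` I \<subseteq> (F x ^^ K) ` I" if "K \<le> L" for K L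
  proof -
    have "(F x ^^ L) t = (F x ^^ K) ((F x ^^ (L - K)) t)" for t
      using that by (simp flip: funpow_add o_apply[of "F x ^^ K"])
    then show ?thesis using FI[of "L - K"] by fastforce
  qed
  obtain k where k: "\<And>i. i \<in> {1..<n} \<Longrightarrow> x i \<notin> closure ((F x ^^ k i) ` I)"
    using avoid by metis
  \<comment> \<open>The sum dominates every \<open>k i\<close>, and \<open>Suc\<close> forces at
    least one iteration, so that \<open>A\<close> lies in the interval from \<alpha> to
    \<beta>.\<close>
  define K where "K = Suc (\<Sum>i\<in>{1..<n}. k i)"
  define A where "A = closure ((F x ^^ K) ` I)"
  have avoidA: "x i \<notin> A" if "i \<in> {1..<n}" for i
  proof -
    have "k i \<le> K" unfolding K_def using member_le_sum[OF that, of k] by simp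
    then show ?thesis using k[OF that] closure_mono[OF antimono] unfolding A_def by blast
  qed
  have "F x ` I \<subseteq> {\<alpha>..\<beta>}" using F_range[OF x] by (rule image_subsetI)
  then have "(F x ^^ K) ` I \<subseteq> {\<alpha>..\<beta>}" using antimono[of 1 K] by (simp add: K_def)
  then have A: "A \<subseteq> {\<alpha>..\<beta>}" unfolding A_def by (intro closure_minimal) auto
  have compactA: "compact A"
    using A bounded_subset[OF bounded_closed_interval] by (simp add: A_def compact_eq_bounded_closed)
  have "A \<inter> x ` {1..<n} = {}" using avoidA by blast
  then obtain \<epsilon> where eps: "\<epsilon> > 0" "\<And>s d. s \<in> A \<Longrightarrow> d \<in> x ` {1..<n} \<Longrightarrow> \<epsilon> \<le> dist s d"
    using separate_compact_closed[OF compactA, of "x ` {1..<n}"] by (auto simp: finite_imp_closed)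
  have contr: "\<bar>F x s - F x t\<bar> \<le> \<rho> * \<bar>s - t\<bar>"
    if "s \<in> A" "t \<in> A" "\<bar>s - t\<bar> < \<epsilon>" for s t
  proof -
    have I: "s \<in> I" "t \<in> I" using that A interval_subset by auto
    obtain i where i: "i \<in> {1..n}" "s \<in> {breakpoint n x (i - 1)..<breakpoint n x i}"
      using piece_exists I by blast
    have "breakpoint n x (i - 1) \<le> t"
    proof (rule ccontr)
      assume neg: "\<not> breakpoint n x (i - 1) \<le> t"
      then have "i - 1 \<in> {1..<n}" using I i by (cases "i - 1 = 0") (auto simp: breakpoint_def)
      moreover from this have "breakpoint n x (i - 1) = x (i - 1)" by (auto simp: breakpoint_def)
      ultimately show False using eps(2)[OF that(1), of "x (i - 1)"] that(3) neg i(2) by (auto simp: dist_real_def)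
    qed
    moreover have "t < breakpoint n x i"
    proof (rule ccontr)
      assume neg: "\<not> t < breakpoint n x i"
      then have "i \<in> {1..<n}" using I i by (cases "i = n") (auto simp: breakpoint_def)
      moreover from this have "breakpoint n x i = x i" by (auto simp: breakpoint_def)
      ultimately show False using eps(2)[OF that(1), of "x i"] that(3) neg i(2) by (auto simp: dist_real_def)
    qed
    ultimately show ?thesis using F_contracts_on_piece[OF x i(1,2)] by auto
  qed
  \<comment> \<open>The map may jump on \<open>I\<close>, but \<open>contr\<close> makes it
    continuous on \<open>A\<close>, which lets invariance pass from the image to its
    closure.\<close>
  have invA: "F x ` A \<subseteq> A"
  proof
    fix y assume "y \<in> F x ` A"
    then obtain s where s: "s \<in> A" "y = F x s" by blast
    show "y \<in> A" unfolding A_def closure_approachable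
    proof (intro allI impI)
      fix e :: real assume "e > 0"
      then obtain b where b: "b \<in> (F x ^^ K) ` I" "dist b s < min e \<epsilon>"
        using s(1) eps(1) unfolding A_def closure_approachable by (metis min_less_iff_conj)
      have "b \<in> A" using subsetD[OF closure_subset b(1)] by (simp add: A_def)
      have "F x b \<in> (F x ^^ Suc K) ` I" using b by auto
      then have "F x b \<in> (F x ^^ K) ` I" using antimono[of K "Suc K"] by auto
      moreover have "\<bar>F x b - F x s\<bar> \<le> \<rho> * \<bar>b - s\<bar>"
        using b(2) s(1) \<open>b \<in> A\<close> by (intro contr) (auto simp: dist_real_def)
      moreover have "\<rho> * \<bar>b - s\<bar> \<le> 1 * \<bar>b - s\<bar>" using rho by (intro mult_right_mono) auto
      ultimately show "\<exists>z\<in>(F x ^^ K) ` I. dist z y < e"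
        using b s by (intro bexI[of _ "F x b"]) (auto simp: dist_real_def)
    qed
  qed
  have "periodic_orbit (F x) (omega_limit (F x) t)" if "t \<in> I" for t
  proof -
    have "(F x ^^ K) t \<in> A" using that closure_subset by (fastforce simp: A_def)
    with omega_limit_locally_contracting[OF compactA invA rho eps(1) contr, of K t]
    obtain q p where "q \<in> A" "p \<ge> 1" "(F x ^^ p) q = q"
        "omega_limit (F x) t = (\<lambda>j. (F x ^^ j) q) ` {0..<p}"
      by blast
    moreover have "q \<in> I" using \<open>q \<in> A\<close> A interval_subset by blast
    ultimately show ?thesis unfolding periodic_orbit_def by blast
  qed
  then show ?thesis by (simp add: asymptotically_periodic_def)
qed

text \<open>A common bound on the size of all finite sets of periodic orbits forces the whole set to
  be finite. Existence comes from the limit set of 0.\<close>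

lemma finitely_many_periodic_orbits:
  assumes x: "x \<in> Omega n" and ap: "asymptotically_periodic (F x)"
  shows "finite {S. periodic_orbit (F x) S} \<and> 1 \<le> card {S. periodic_orbit (F x) S} \<and>
    card {S. periodic_orbit (F x) S} \<le> n"
proof -
  have "finite {S. periodic_orbit (F x) S} \<and> card {S. periodic_orbit (F x) S} \<le> n"
    by (intro finite_if_finite_subsets_card_bdd card_periodic_orbits_le[OF x]) auto
  moreover have "omega_limit (F x) 0 \<in> {S. periodic_orbit (F x) S}"
    using ap by (simp add: asymptotically_periodic_def)
  ultimately show ?thesis by (metis card_gt_0_iff empty_iff less_eq_Suc_le One_nat_def)
qed

end

section \<open>Null sets of breakpoints\<close>

lemma AE_PiM_lborel_coordinate:
  assumes "finite J" "i \<in> J" "AE y in lborel. Q (y::real)"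
  shows "AE x in PiM J (\<lambda>_. lborel). Q (x i)"
proof -
  interpret product_sigma_finite "\<lambda>_::'a. lborel :: real measure" by standard
  obtain N where N: "{y. \<not> Q y} \<subseteq> N" "emeasure lborel N = 0" "N \<in> sets lborel"
    using AE_E[OF assms(3)] by (auto simp: space_lborel)
  define E where "E = Pi\<^sub>E J (\<lambda>j. if j = i then N else UNIV)"
  have "emeasure (PiM J (\<lambda>_. lborel)) E = (\<Prod>j\<in>J. emeasure lborel (if j = i then N else UNIV))"
    unfolding E_def using assms(1) N(3) by (intro emeasure_PiM) auto
  also have "\<dots> = 0" using assms(1,2) N(2) by (auto intro!: prod_zero)
  finally have "emeasure (PiM J (\<lambda>_. lborel)) E = 0" .
  moreover have "E \<in> sets (PiM J (\<lambda>_. lborel))"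
    unfolding E_def using assms(1) N(3) by (intro sets_PiM_I_finite) auto
  ultimately have "E \<in> null_sets (PiM J (\<lambda>_. lborel))" by blast
  then show ?thesis
    by (rule AE_I') (use N(1) in \<open>auto simp: E_def space_PiM PiE_def\<close>)
qed

text \<open>Integrate over the coordinate \<open>l\<close> first: with the others fixed, the only
  excluded value of \<open>x l\<close> is \<open>g (x i)\<close>, a single point.\<close>

lemma AE_PiM_lborel_off_graph:
  fixes g :: "real \<Rightarrow> real"
  assumes "finite J" "i \<in> J" "l \<in> J" "i \<noteq> l" and [measurable]: "g \<in> borel_measurable borel"
  shows "AE x in PiM J (\<lambda>_. lborel). g (x i) \<noteq> x l"
proof -
  interpret product_sigma_finite "\<lambda>_::'a. lborel :: real measure" by standard
  define J' where "J' = J - {l}"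
  have J: "J = insert l J'" "finite J'" "l \<notin> J'" "i \<in> J'" using assms by (auto simp: J'_def)
  have [measurable]: "(\<lambda>x. x i) \<in> borel_measurable (PiM J (\<lambda>_. lborel))"
      "(\<lambda>x. x l) \<in> borel_measurable (PiM J (\<lambda>_. lborel))"
    using assms measurable_component_singleton[of _ J "\<lambda>_. lborel :: real measure"] by auto
  define h :: "('a \<Rightarrow> real) \<Rightarrow> ennreal" where "h x = indicator {0} (g (x i) - x l)" for x
  have h[measurable]: "h \<in> borel_measurable (PiM J (\<lambda>_. lborel))" unfolding h_def by measurable
  have "(\<integral>\<^sup>+ x. h x \<partial>PiM J (\<lambda>_. lborel)) = (\<integral>\<^sup>+ x. (\<integral>\<^sup>+ y. h (x(l := y)) \<partial>lborel) \<partial>PiM J' (\<lambda>_. lborel))"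
    using h unfolding J(1) by (intro product_nn_integral_insert J)
  also have "\<dots> = (\<integral>\<^sup>+ x. 0 \<partial>PiM J' (\<lambda>_. lborel :: real measure))"
  proof (rule nn_integral_cong)
    fix x :: "'a \<Rightarrow> real"
    have "h (x(l := y)) = indicator {g (x i)} y" for y
      using assms(4) by (auto simp: h_def split: split_indicator)
    then show "(\<integral>\<^sup>+ y. h (x(l := y)) \<partial>lborel) = 0" by simp
  qed
  finally have "AE x in PiM J (\<lambda>_. lborel). h x = 0" by (simp add: nn_integral_0_iff_AE)
  then show ?thesis by eventually_elim (auto simp: h_def split: split_indicator)
qed

lemma emeasure_Union_cball_le:
  fixes C :: "real set"
  assumes "finite C" "card C \<le> k" "r \<ge> 0"
  shows "emeasure lborel (\<Union>c\<in>C. cball c r) \<le> ennreal (real k * (2 * r))"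
proof -
  have "emeasure lborel (\<Union>c\<in>C. cball c r) \<le> (\<Sum>c\<in>C. emeasure lborel (cball c r))"
    using assms(1) by (intro emeasure_subadditive_finite) auto
  also have "\<dots> = (\<Sum>c\<in>C. ennreal (2 * r))"
    using assms(3) by (intro sum.cong) (auto simp: cball_eq_atLeastAtMost)
  also have "\<dots> = ennreal (real (card C) * (2 * r))"
    using assms(3) by (simp add: ennreal_mult ennreal_of_nat_eq_real_of_nat)
  also have "\<dots> \<le> ennreal (real k * (2 * r))"
    using assms by (intro ennreal_leI mult_right_mono) auto
  finally show ?thesis .
qed

section \<open>Compositions of branches and genericity\<close>

context contraction_family
begin

text \<open>The new branch is innermost, so it acts first; this matches splitting an iterate into
  its first step followed by the rest.\<close>

primrec comps :: "nat \<Rightarrow> (real \<Rightarrow> real) set" where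
  "comps 0 = {id}"
| "comps (Suc N) = (\<lambda>(g, i). g \<circ> \<phi> i) ` (comps N \<times> {1..n})"

lemma finite_comps: "finite (comps N)"
  by (induction N) auto

lemma comps_SucI: "g \<in> comps N \<Longrightarrow> i \<in> {1..n} \<Longrightarrow> g \<circ> \<phi> i \<in> comps (Suc N)"
  by force

lemma comps_lipschitz: "g \<in> comps N \<Longrightarrow> \<bar>g s - g t\<bar> \<le> \<rho> ^ N * \<bar>s - t\<bar>"
proof (induction N arbitrary: g s t)
  case (Suc N)
  then obtain g' i where g: "g' \<in> comps N" "i \<in> {1..n}" "g = g' \<circ> \<phi> i" by auto
  have "\<bar>g s - g t\<bar> \<le> \<rho> ^ N * \<bar>\<phi> i s - \<phi> i t\<bar>" using Suc.IH[OF g(1)] g(3) by simp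
  also have "\<dots> \<le> \<rho> ^ N * (\<rho> * \<bar>s - t\<bar>)" using lipschitz[OF g(2)] rho by (intro mult_left_mono) auto
  finally show ?case by (simp add: mult.commute mult.left_commute)
qed simp

lemma comps_range: "g \<in> comps (Suc N) \<Longrightarrow> g t \<in> {\<alpha>..\<beta>}"
proof (induction N arbitrary: g t)
  case 0
  then show ?case using range by auto
next
  case (Suc N)
  then obtain g' i where "g' \<in> comps (Suc N)" "i \<in> {1..n}" "g = g' \<circ> \<phi> i" by (auto simp del: comps.simps(2) simp: comps.simps(2)[of "Suc N"])
  then show ?case using Suc.IH by simp
qed

lemma continuous_on_comps:
  assumes "g \<in> comps N"
  shows "continuous_on S g"
proof (rule lipschitz_on_continuous_on)
  show "(\<rho> ^ N)-lipschitz_on S g"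
    using comps_lipschitz[OF assms] rho by (intro lipschitz_onI) (auto simp: dist_real_def)
qed

lemma isCont_\<phi>: "i \<in> {1..n} \<Longrightarrow> isCont (\<phi> i) t"
  using continuous_on_comps[of "\<phi> i" "Suc 0" UNIV] comps_SucI[of id 0 i]
  by (simp add: continuous_on_eq_continuous_at)

definition generic :: "(nat \<Rightarrow> real) \<Rightarrow> bool" where
  "generic x \<longleftrightarrow> (\<forall>N. \<forall>g\<in>comps (Suc N). \<forall>i\<in>{1..<n}. \<forall>l\<in>{1..<n}. g (x i) \<noteq> x l)"

text \<open>There are countably many conditions. For \<open>i = l\<close> a contraction has at most
  one fixed point, so at most one value of the coordinate is excluded; for
  \<open>i \<noteq> l\<close> the exceptions lie on the graph of a continuous function.\<close>

lemma AE_generic: "AE x in PiM {1..<n} (\<lambda>_. lborel). generic x"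
proof -
  have "AE x in PiM {1..<n} (\<lambda>_. lborel). g (x i) \<noteq> x l"
    if g: "g \<in> comps (Suc N)" and il: "i \<in> {1..<n}" "l \<in> {1..<n}" for N g i l
  proof (cases "i = l")
    case True
    have "\<rho> ^ Suc N < 1" 
      using rho mult_left_mono[OF power_le_one[OF rho(1), of N] rho(1)] by simp
    then have unique: "s = t" if "g s = s" "g t = t" for s t
      using comps_lipschitz[OF g, of s t] that
      by (metis abs_ge_zero less_le_not_le mult_le_cancel_right1 order_antisym_conv abs_le_zero_iff eq_iff_diff_eq_0 linorder_not_le)
    have "AE y in lborel. g y \<noteq> y"
    proof (cases "\<exists>c. g c = c")
      case True
      then obtain c where c: "g c = c" by blast
      show ?thesis using AE_lborel_singleton[of c] by eventually_elim (use unique[OF _ c] in blast)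
    qed simp
    then show ?thesis using il True AE_PiM_lborel_coordinate[of "{1..<n}" i "\<lambda>y. g y \<noteq> y"] by simp
  next
    case False
    have "g \<in> borel_measurable borel" by (intro borel_measurable_continuous_onI continuous_on_comps[OF g])
    then show ?thesis using il False by (intro AE_PiM_lborel_off_graph) auto
  qed
  then show ?thesis unfolding generic_def
    by (simp add: AE_all_countable AE_ball_countable countable_finite finite_comps del: comps.simps)
qed

section \<open>Iterates under perturbation of breakpoints and point\<close>

lemma eventually_between_breakpoints:
  assumes "breakpoint n x\<^sub>0 i < t" "t < breakpoint n x\<^sub>0 j"
  shows "\<forall>\<^sub>F z in nhds (x\<^sub>0, t). breakpoint n (fst z) i < snd z \<and> snd z < breakpoint n (fst z) j"
proof -
  have coord: "continuous_on UNIV (\<lambda>z::(nat \<Rightarrow> real) \<times> real. fst z k)" for k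
    by (rule continuous_on_compose2[OF continuous_on_product_coordinates[of k]]) (auto intro: continuous_intros)
  have cont: "continuous_on UNIV (\<lambda>z::(nat \<Rightarrow> real) \<times> real. breakpoint n (fst z) k)" for k
    unfolding breakpoint_def using coord[of k] by (cases "k = 0"; cases "k = n") simp_all
  \<comment> \<open>Both inequalities are open conditions on the pair, so perturbing breakpoints and
    point together preserves them.\<close>
  have "open {z. breakpoint n (fst z) i < snd z}" "open {z. snd z < breakpoint n (fst z) j}"
    by (intro open_Collect_less cont continuous_on_snd continuous_on_id)+
  then have "\<forall>\<^sub>F z in nhds (x\<^sub>0, t). z \<in> {z. breakpoint n (fst z) i < snd z}"
      "\<forall>\<^sub>F z in nhds (x\<^sub>0, t). z \<in> {z. snd z < breakpoint n (fst z) j}"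
    using assms by (intro eventually_nhds_in_open; simp)+
  then show ?thesis by eventually_elim simp
qed

text \<open>The member of \<open>G\<close> may vary with the pair \<open>z\<close>, while
  \<open>G\<close> itself is fixed for all nearby breakpoints and points. The restriction to
  \<open>Omega n\<close> is there because nearby functions need not be extensional.\<close>

definition captures :: "nat \<Rightarrow> (nat \<Rightarrow> real) \<Rightarrow> real \<Rightarrow> (real \<Rightarrow> real) set \<Rightarrow> bool" where
  "captures N x\<^sub>0 t G \<longleftrightarrow>
     (\<forall>\<^sub>F z in nhds (x\<^sub>0, t). fst z \<in> Omega n \<longrightarrow> (F (fst z) ^^ N) (snd z) \<in> (\<lambda>g. g (snd z)) ` G)"

lemma breakpoint_inner: "k \<in> {1..<n} \<Longrightarrow> breakpoint n x k = x k"
  by (auto simp: breakpoint_def)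

lemma captures_continuity_point:
  assumes "x\<^sub>0 \<in> Omega n" "t \<in> {0<..<1}" "t \<notin> x\<^sub>0 ` {1..<n}"
  obtains i where "i \<in> {1..n}" "captures 1 x\<^sub>0 t (\<phi> ` {i})"
proof -
  obtain i where i: "i \<in> {1..n}" "t \<in> {breakpoint n x\<^sub>0 (i - 1)..<breakpoint n x\<^sub>0 i}"
    using piece_exists[of t x\<^sub>0] assms(2) by auto
  have "breakpoint n x\<^sub>0 (i - 1) \<noteq> t"
  proof (cases "i = 1")
    case True
    then show ?thesis using assms(2) by (simp add: breakpoint_def)
  next
    case False
    then have "i - 1 \<in> {1..<n}" using i(1) by auto
    then have "x\<^sub>0 (i - 1) \<noteq> t" using assms(3) by blast
    then show ?thesis using breakpoint_inner[OF \<open>i - 1 \<in> {1..<n}\<close>] by simp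
  qed
  then have "breakpoint n x\<^sub>0 (i - 1) < t" "t < breakpoint n x\<^sub>0 i" using i(2) by auto
  from eventually_between_breakpoints[OF this]
  have "captures 1 x\<^sub>0 t (\<phi> ` {i})"
    unfolding captures_def by eventually_elim (use i(1) in \<open>auto intro!: pc_map_eq\<close>)
  with i(1) show ?thesis by (rule that)
qed

text \<open>A nearby point lies between the perturbed breakpoints \<open>j - 1\<close> and
  \<open>j + 1\<close>, hence in piece \<open>j\<close> or \<open>Suc j\<close>, according to its
  side of the perturbed breakpoint \<open>j\<close>.\<close>

lemma captures_breakpoint:
  assumes "x\<^sub>0 \<in> Omega n" "j \<in> {1..<n}"
  shows "captures 1 x\<^sub>0 (x\<^sub>0 j) (\<phi> ` {j, Suc j})"
proof -
  have mono: "breakpoint n x\<^sub>0 (i - 1) < breakpoint n x\<^sub>0 i" if "i \<in> {1..n}" for i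
    using assms(1) that by (simp add: Omega_def)
  have "breakpoint n x\<^sub>0 (j - 1) < x\<^sub>0 j" "x\<^sub>0 j < breakpoint n x\<^sub>0 (Suc j)"
    using mono[of j] mono[of "Suc j"] assms(2) by (auto simp: breakpoint_def split: if_splits)
  from eventually_between_breakpoints[OF this]
  show ?thesis unfolding captures_def
  proof eventually_elim
    case (elim z)
    show ?case
    proof
      assume z: "fst z \<in> Omega n"
      show "(F (fst z) ^^ 1) (snd z) \<in> (\<lambda>g. g (snd z)) ` \<phi> ` {j, Suc j}"
      proof (cases "snd z < breakpoint n (fst z) j")
        case True
        then have "F (fst z) (snd z) = \<phi> j (snd z)" using assms(2) elim by (intro pc_map_eq[OF z]) auto
        then show ?thesis by simp
      next
        case False
        then have "F (fst z) (snd z) = \<phi> (Suc j) (snd z)" using assms(2) elim by (intro pc_map_eq[OF z]) auto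
        then show ?thesis by simp
      qed
    qed
  qed
qed

text \<open>Although the map can jump at \<open>t\<close>, each branch is continuous and pulls back
  the neighbourhood of its own image point; finitely many such neighbourhoods are
  intersected.\<close>

lemma captures_Suc:
  assumes "captures 1 x\<^sub>0 t (\<phi> ` J)" "J \<subseteq> {1..n}"
    and "\<And>i. i \<in> J \<Longrightarrow> captures N x\<^sub>0 (\<phi> i t) (G i)"
  shows "captures (Suc N) x\<^sub>0 t (\<Union>i\<in>J. (\<lambda>g. g \<circ> \<phi> i) ` G i)"
proof -
  have "\<forall>\<^sub>F z in nhds (x\<^sub>0, t). fst z \<in> Omega n \<longrightarrow>
      (F (fst z) ^^ N) (\<phi> i (snd z)) \<in> (\<lambda>g. g (\<phi> i (snd z))) ` G i" if "i \<in> J" for i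
  proof -
    have "filterlim (\<phi> i) (nhds (\<phi> i t)) (nhds t)"
      using isCont_\<phi>[of i t] that assms(2) by (auto simp: isCont_def tendsto_at_iff_tendsto_nhds)
    then have "((\<lambda>z. (fst z, \<phi> i (snd z))) \<longlongrightarrow> (x\<^sub>0, \<phi> i t)) (nhds (x\<^sub>0, t))"
      by (intro tendsto_Pair) (auto simp: nhds_prod intro: filterlim_compose filterlim_fst filterlim_snd)
    from eventually_compose_filterlim[OF assms(3)[OF that, unfolded captures_def] this]
    show ?thesis by simp
  qed
  then have "\<forall>\<^sub>F z in nhds (x\<^sub>0, t). \<forall>i\<in>J. fst z \<in> Omega n \<longrightarrow>
      (F (fst z) ^^ N) (\<phi> i (snd z)) \<in> (\<lambda>g. g (\<phi> i (snd z))) ` G i"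
    using finite_subset[OF assms(2)] by (intro eventually_ball_finite) auto
  with assms(1)[unfolded captures_def] show ?thesis unfolding captures_def
  proof eventually_elim
    case (elim z)
    show ?case
    proof
      assume z: "fst z \<in> Omega n"
      then obtain i where i: "i \<in> J" "F (fst z) (snd z) = \<phi> i (snd z)" using elim(1) by auto
      then obtain g where "g \<in> G i" "(F (fst z) ^^ N) (\<phi> i (snd z)) = g (\<phi> i (snd z))"
        using elim(2) z by blast
      then show "(F (fst z) ^^ Suc N) (snd z) \<in> (\<lambda>g. g (snd z)) ` (\<Union>i\<in>J. (\<lambda>g. g \<circ> \<phi> i) ` G i)"
        using i by (intro image_eqI[of _ _ "g \<circ> \<phi> i"]) (auto simp: funpow_Suc_right simp del: funpow.simps)
    qed
  qed
qed

lemma \<phi>_in_open_unit_interval: "i \<in> {1..n} \<Longrightarrow> \<phi> i t \<in> {0<..<1}"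
  using range[of i t] bounds by auto

text \<open>No composition, the empty one included, sends \<open>t\<close> to a breakpoint, so every
  step takes place in the interior of a piece and one branch suffices each time.\<close>

lemma captures_off_breakpoints:
  assumes x\<^sub>0: "x\<^sub>0 \<in> Omega n" and t: "t \<in> {0<..<1}"
    and off: "\<And>M g. g \<in> comps M \<Longrightarrow> g t \<notin> x\<^sub>0 ` {1..<n}"
  shows "\<exists>g\<in>comps N. captures N x\<^sub>0 t {g}"
  using t off
proof (induction N arbitrary: t)
  case 0
  then show ?case by (simp add: captures_def)
next
  case (Suc N)
  have "id \<in> comps 0" by simp
  from Suc.prems(2)[OF this] have "t \<notin> x\<^sub>0 ` {1..<n}" by simp
  then obtain i where i: "i \<in> {1..n}" "captures 1 x\<^sub>0 t (\<phi> ` {i})"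
    using captures_continuity_point[OF x\<^sub>0 Suc.prems(1)] by blast
  have "g (\<phi> i t) \<notin> x\<^sub>0 ` {1..<n}" if "g \<in> comps M" for M g
    using Suc.prems(2)[OF comps_SucI[OF that i(1)]] by simp
  then obtain g where g: "g \<in> comps N" "captures N x\<^sub>0 (\<phi> i t) {g}"
    using Suc.IH[OF \<phi>_in_open_unit_interval[OF i(1)]] by blast
  have "captures (Suc N) x\<^sub>0 t (\<Union>i\<in>{i}. (\<lambda>g. g \<circ> \<phi> i) ` {g})"
    using i g by (intro captures_Suc) auto
  then have "captures (Suc N) x\<^sub>0 t {g \<circ> \<phi> i}" by simp
  then show ?case using comps_SucI[OF g(1) i(1)] by blast
qed

text \<open>By genericity an orbit meets the breakpoints at most once, so that two branches suffice
  whatever the number of iterations.\<close>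

lemma captures_generic:
  assumes x\<^sub>0: "x\<^sub>0 \<in> Omega n" "generic x\<^sub>0" and t: "t \<in> {0<..<1}"
  shows "\<exists>g\<in>comps N. \<exists>h\<in>comps N. captures N x\<^sub>0 t {g, h}"
  using t
proof (induction N arbitrary: t)
  case 0
  then show ?case by (simp add: captures_def)
next
  case (Suc N)
  show ?case
  proof (cases "t \<in> x\<^sub>0 ` {1..<n}")
    case False
    then obtain i where i: "i \<in> {1..n}" "captures 1 x\<^sub>0 t (\<phi> ` {i})"
      using captures_continuity_point[OF x\<^sub>0(1) Suc.prems(1)] by blast
    obtain g h where g: "g \<in> comps N" "h \<in> comps N" "captures N x\<^sub>0 (\<phi> i t) {g, h}"
      using Suc.IH[OF \<phi>_in_open_unit_interval[OF i(1)]] by blast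
    have "captures (Suc N) x\<^sub>0 t (\<Union>i\<in>{i}. (\<lambda>g. g \<circ> \<phi> i) ` {g, h})"
      using i g by (intro captures_Suc) auto
    then have "captures (Suc N) x\<^sub>0 t {g \<circ> \<phi> i, h \<circ> \<phi> i}" by simp
    then show ?thesis using comps_SucI[OF g(1) i(1)] comps_SucI[OF g(2) i(1)] by blast
  next
    case True
    then obtain j where j: "j \<in> {1..<n}" "t = x\<^sub>0 j" by blast
    \<comment> \<open>Genericity keeps both continuations \<open>\<phi> j t\<close> and
      \<open>\<phi> (Suc j) t\<close> off the breakpoints under all further compositions, so there
      is no further branching.\<close>
    have "\<exists>g\<in>comps N. captures N x\<^sub>0 (\<phi> i t) {g}" if i: "i \<in> {j, Suc j}" for i
    proof (rule captures_off_breakpoints[OF x\<^sub>0(1)])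
      have i': "i \<in> {1..n}" using i j by auto
      show "\<phi> i t \<in> {0<..<1}" by (rule \<phi>_in_open_unit_interval[OF i'])
      show "g (\<phi> i t) \<notin> x\<^sub>0 ` {1..<n}" if "g \<in> comps M" for M g
        using comps_SucI[OF that i'] x\<^sub>0(2) j unfolding generic_def by (fastforce simp del: comps.simps)
    qed
    then obtain g h where gh: "g \<in> comps N" "captures N x\<^sub>0 (\<phi> j t) {g}"
        "h \<in> comps N" "captures N x\<^sub>0 (\<phi> (Suc j) t) {h}"
      by blast
    have "captures (Suc N) x\<^sub>0 t (\<Union>i\<in>{j, Suc j}. (\<lambda>g. g \<circ> \<phi> i) ` (if i = j then {g} else {h}))"
      using j gh captures_breakpoint[OF x\<^sub>0(1) j(1)] by (intro captures_Suc) auto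
    then have "captures (Suc N) x\<^sub>0 t {g \<circ> \<phi> j, h \<circ> \<phi> (Suc j)}" by (simp add: insert_commute)
    moreover have "g \<circ> \<phi> j \<in> comps (Suc N)" "h \<circ> \<phi> (Suc j) \<in> comps (Suc N)"
      using gh j by (auto intro!: comps_SucI simp del: comps.simps)
    ultimately show ?thesis by blast
  qed
qed

text \<open>Compactness of the interval from \<alpha> to \<beta> gives one neighbourhood
  \<open>U\<close> and one radius \<delta> for all \<open>t\<close>. The compositions depend on
  \<open>t\<close> but not on \<open>x\<close>.\<close>

lemma uniformly_captures:
  assumes x\<^sub>0: "x\<^sub>0 \<in> Omega n" "generic x\<^sub>0"
  obtains U \<delta> where "open U" "x\<^sub>0 \<in> U" "\<delta> > 0"
    "\<And>t. t \<in> {\<alpha>..\<beta>} \<Longrightarrow> \<exists>g\<in>comps N. \<exists>h\<in>comps N. \<forall>x\<in>U \<inter> Omega n. \<forall>s.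
       \<bar>s - t\<bar> < \<delta> \<longrightarrow> (F x ^^ N) s \<in> {g s, h s}"
proof -
  have "\<exists>U d g h. open U \<and> x\<^sub>0 \<in> U \<and> d > 0 \<and> g \<in> comps N \<and> h \<in> comps N \<and>
      (\<forall>x\<in>U \<inter> Omega n. \<forall>s. \<bar>s - t\<bar> < d \<longrightarrow> (F x ^^ N) s \<in> {g s, h s})"
    if t: "t \<in> {\<alpha>..\<beta>}" for t
  proof -
    have "t \<in> {0<..<1}" using t bounds by auto
    then obtain g h where gh: "g \<in> comps N" "h \<in> comps N" "captures N x\<^sub>0 t {g, h}"
      using captures_generic[OF x\<^sub>0] by blast
    then obtain P Q where PQ: "eventually P (nhds x\<^sub>0)" "eventually Q (nhds t)"
        "\<And>x s. P x \<Longrightarrow> Q s \<Longrightarrow> x \<in> Omega n \<Longrightarrow> (F x ^^ N) s \<in> {g s, h s}"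
      unfolding captures_def nhds_prod eventually_prod_filter by auto
    obtain U where "open U" "x\<^sub>0 \<in> U" "\<And>x. x \<in> U \<Longrightarrow> P x"
      using PQ(1) unfolding eventually_nhds by blast
    moreover obtain d where "d > 0" "\<And>s. \<bar>s - t\<bar> < d \<Longrightarrow> Q s"
      using PQ(2) unfolding eventually_nhds_metric dist_real_def by blast
    ultimately show ?thesis using PQ(3) gh(1,2) by (intro exI[of _ U] exI[of _ d] exI[of _ g] exI[of _ h]) auto
  qed
  then obtain U d g h where U: "\<And>t. t \<in> {\<alpha>..\<beta>} \<Longrightarrow> open (U t) \<and> x\<^sub>0 \<in> U t \<and> d t > 0 \<and>
      g t \<in> comps N \<and> h t \<in> comps N \<and>
      (\<forall>x\<in>U t \<inter> Omega n. \<forall>s. \<bar>s - t\<bar> < d t \<longrightarrow> (F x ^^ N) s \<in> {g t s, h t s})"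
    by metis
  \<comment> \<open>Half radii leave room: a point within \<delta> of \<open>t'\<close> is still
    within \<open>d t\<close> of the centre \<open>t\<close> whose half ball contains
    \<open>t'\<close>.\<close>
  have cover: "{\<alpha>..\<beta>} \<subseteq> (\<Union>t\<in>{\<alpha>..\<beta>}. ball t (d t / 2))" using U by fastforce
  obtain T where T: "T \<subseteq> {\<alpha>..\<beta>}" "finite T" "{\<alpha>..\<beta>} \<subseteq> (\<Union>t\<in>T. ball t (d t / 2))"
    by (rule compactE_image[OF compact_Icc _ cover]) auto
  define V where "V = (\<Inter>t\<in>T. U t)"
  define \<delta> where "\<delta> = Min (insert 1 ((\<lambda>t. d t / 2) ` T))"
  show ?thesis
  proof (rule that[of V \<delta>])
    show "open V" unfolding V_def using T U by (intro open_INT) auto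
    show "x\<^sub>0 \<in> V" unfolding V_def using T U by auto
    show "\<delta> > 0" unfolding \<delta>_def using T U by (subst Min_gr_iff) auto
    fix t' assume "t' \<in> {\<alpha>..\<beta>}"
    then obtain t where t: "t \<in> T" "\<bar>t' - t\<bar> < d t / 2" using T(3) by (auto simp: dist_real_def abs_minus_commute)
    have "\<delta> \<le> d t / 2" unfolding \<delta>_def using T(2) t(1) by (intro Min_le) auto
    then have "\<bar>s - t\<bar> < d t" if "\<bar>s - t'\<bar> < \<delta>" for s using that t(2) by linarith
    moreover have "x \<in> U t" if "x \<in> V" for x using that t(1) by (auto simp: V_def)
    ultimately show "\<exists>g\<in>comps N. \<exists>h\<in>comps N. \<forall>x\<in>V \<inter> Omega n. \<forall>s.
        \<bar>s - t'\<bar> < \<delta> \<longrightarrow> (F x ^^ N) s \<in> {g s, h s}"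
      using U[OF subsetD[OF T(1) t(1)]] by (meson IntD1 IntD2 IntI)
  qed
qed

text \<open>Every block of \<open>N\<close> steps replaces a centre \<open>c\<close> by the two
  centres \<open>g c c\<close> and \<open>h c c\<close> and shrinks the radius by the factor
  \<open>\<rho> ^ N\<close>. The centres are chosen before \<open>x\<close>, so one cover serves all
  of \<open>U\<close>.\<close>

lemma iterates_covered:
  assumes "N \<ge> 1" "\<delta> > 0" "U \<subseteq> Omega n"
    and two: "\<And>t. t \<in> {\<alpha>..\<beta>} \<Longrightarrow> \<exists>g\<in>comps N. \<exists>h\<in>comps N. \<forall>x\<in>U. \<forall>s.
       \<bar>s - t\<bar> < \<delta> \<longrightarrow> (F x ^^ N) s \<in> {g s, h s}"
  obtains M :: nat and C where "\<And>m. finite (C m)" "\<And>m. card (C m) \<le> M * 2 ^ m"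
    "\<And>m x. x \<in> U \<Longrightarrow> (F x ^^ (N * m + 1)) ` I \<subseteq> (\<Union>c\<in>C m. cball c ((\<rho> ^ N) ^ m * (\<delta> / 2)))"
proof -
  have cover: "{\<alpha>..\<beta>} \<subseteq> (\<Union>t\<in>{\<alpha>..\<beta>}. ball t (\<delta> / 2))" using assms(2) by fastforce
  obtain T where T: "T \<subseteq> {\<alpha>..\<beta>}" "finite T" "{\<alpha>..\<beta>} \<subseteq> (\<Union>t\<in>T. ball t (\<delta> / 2))"
    by (rule compactE_image[OF compact_Icc _ cover]) auto
  \<comment> \<open>The extra step in \<open>N * m + 1\<close> first brings \<open>I\<close> into
    the interval from \<alpha> to \<beta>. The centres stay there because compositions in
    \<open>comps N\<close> are nonempty, and radii of at most \<open>\<delta> / 2\<close> stay below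
    \<delta>, so \<open>two\<close> applies at each stage.\<close>
  have "\<exists>C\<subseteq>{\<alpha>..\<beta>}. finite C \<and> card C \<le> card T * 2 ^ m \<and>
      (\<forall>x\<in>U. (F x ^^ (N * m + 1)) ` I \<subseteq> (\<Union>c\<in>C. cball c ((\<rho> ^ N) ^ m * (\<delta> / 2))))" for m
  proof (induction m)
    case 0
    have "F x ` I \<subseteq> (\<Union>c\<in>T. cball c (\<delta> / 2))" if "x \<in> U" for x
    proof (rule image_subsetI)
      fix s assume "s \<in> I"
      then have "F x s \<in> {\<alpha>..\<beta>}" using F_range assms(3) that by blast
      then have "F x s \<in> (\<Union>t\<in>T. ball t (\<delta> / 2))" using T(3) by blast
      then show "F x s \<in> (\<Union>c\<in>T. cball c (\<delta> / 2))" using ball_subset_cball by blast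
    qed
    then show ?case using T by (intro exI[of _ T]) auto
  next
    case (Suc m)
    let ?r = "(\<rho> ^ N) ^ m * (\<delta> / 2)"
    obtain C where C: "C \<subseteq> {\<alpha>..\<beta>}" "finite C" "card C \<le> card T * 2 ^ m"
        "\<And>x. x \<in> U \<Longrightarrow> (F x ^^ (N * m + 1)) ` I \<subseteq> (\<Union>c\<in>C. cball c ?r)"
      using Suc.IH by blast
    obtain g h where gh: "\<And>t. t \<in> {\<alpha>..\<beta>} \<Longrightarrow> g t \<in> comps N \<and> h t \<in> comps N \<and>
        (\<forall>x\<in>U. \<forall>s. \<bar>s - t\<bar> < \<delta> \<longrightarrow> (F x ^^ N) s \<in> {g t s, h t s})"
      using two by metis
    define C' where "C' = (\<lambda>c. g c c) ` C \<union> (\<lambda>c. h c c) ` C"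
    have r: "?r < \<delta>"
    proof -
      have "?r \<le> 1 * (\<delta> / 2)"
        using rho assms(2) by (intro mult_right_mono power_le_one) auto
      then show ?thesis using assms(2) by simp
    qed
    have "g c c \<in> {\<alpha>..\<beta>}" "h c c \<in> {\<alpha>..\<beta>}" if "c \<in> C" for c
    proof -
      have "N = Suc (N - 1)" using assms(1) by simp
      moreover have "g c \<in> comps N" "h c \<in> comps N" using gh[OF subsetD[OF C(1) that]] by auto
      ultimately show "g c c \<in> {\<alpha>..\<beta>}" "h c c \<in> {\<alpha>..\<beta>}" by (metis comps_range)+
    qed
    then have "C' \<subseteq> {\<alpha>..\<beta>}" unfolding C'_def by (intro Un_least image_subsetI)
    moreover have "finite C'" unfolding C'_def using C(2) by simp
    moreover have "card C' \<le> card T * 2 ^ Suc m"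
    proof -
      have "card C' \<le> card C + card C"
        unfolding C'_def
        by (rule order_trans[OF card_Un_le add_mono[OF card_image_le[OF C(2)] card_image_le[OF C(2)]]])
      then show ?thesis using C(3) by simp
    qed
    moreover have "(F x ^^ (N * Suc m + 1)) ` I \<subseteq> (\<Union>c\<in>C'. cball c ((\<rho> ^ N) ^ Suc m * (\<delta> / 2)))"
      if x: "x \<in> U" for x
    proof (rule image_subsetI)
      fix t assume "t \<in> I"
      define s where "s = (F x ^^ (N * m + 1)) t"
      have "s \<in> (\<Union>c\<in>C. cball c ?r)"
        unfolding s_def by (rule subsetD[OF C(4)[OF x] imageI[OF \<open>t \<in> I\<close>]])
      then obtain c where c: "c \<in> C" "\<bar>s - c\<bar> \<le> ?r" by (auto simp: dist_real_def abs_minus_commute)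
      then have c': "c \<in> {\<alpha>..\<beta>}" using C(1) by blast
      have "(F x ^^ N) s \<in> {g c s, h c s}" using gh[OF c'] x c(2) r by auto
      then obtain k where k: "k \<in> comps N" "k c \<in> C'" "(F x ^^ N) s = k s"
        using gh[OF c'] c(1) by (auto simp: C'_def)
      have "\<bar>k s - k c\<bar> \<le> \<rho> ^ N * \<bar>s - c\<bar>" by (rule comps_lipschitz[OF k(1)])
      also have "\<dots> \<le> \<rho> ^ N * ?r" using c(2) rho by (intro mult_left_mono) auto
      finally have "k s \<in> cball (k c) ((\<rho> ^ N) ^ Suc m * (\<delta> / 2))"
        by (simp add: dist_real_def abs_minus_commute mult.assoc)
      moreover have "(F x ^^ (N * Suc m + 1)) t = (F x ^^ N) s"
      proof -
        have "N * Suc m + 1 = N + (N * m + 1)" by simp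
        then show ?thesis unfolding s_def by (simp only: funpow_add o_apply)
      qed
      ultimately show "(F x ^^ (N * Suc m + 1)) t \<in> (\<Union>c\<in>C'. cball c ((\<rho> ^ N) ^ Suc m * (\<delta> / 2)))"
        using k by auto
    qed
    ultimately show ?case by blast
  qed
  then obtain C where C: "\<And>m. finite (C m) \<and> card (C m) \<le> card T * 2 ^ m \<and>
      (\<forall>x\<in>U. (F x ^^ (N * m + 1)) ` I \<subseteq> (\<Union>c\<in>C m. cball c ((\<rho> ^ N) ^ m * (\<delta> / 2))))"
    by metis
  show ?thesis by (rule that[of C "card T"]) (use C in blast)+
qed

text \<open>The cover at level \<open>m\<close> has total length at most
  \<open>(2 * \<rho> ^ N) ^ m * (M * \<delta>)\<close>, which tends to 0 by the choice of
  \<open>N\<close>, so the intersection of the covers is null. A breakpoint outside it misses one of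
  these closed covers, hence the closure of some iterated image.\<close>

lemma asymptotically_periodic_near_generic:
  assumes x\<^sub>0: "x\<^sub>0 \<in> Omega n" "generic x\<^sub>0"
  obtains U Z where "open U" "x\<^sub>0 \<in> U" "Z \<in> null_sets lborel"
    "\<forall>x\<in>U \<inter> Omega n. (\<forall>i\<in>{1..<n}. x i \<notin> Z) \<longrightarrow> asymptotically_periodic (F x)"
proof -
  obtain N where N: "\<rho> ^ N < 1 / 2" using real_arch_pow_inv[of "1 / 2" \<rho>] rho by auto
  then have "N \<ge> 1" by (cases N) auto
  obtain U \<delta> where U: "open U" "x\<^sub>0 \<in> U" "\<delta> > 0"
    "\<And>t. t \<in> {\<alpha>..\<beta>} \<Longrightarrow> \<exists>g\<in>comps N. \<exists>h\<in>comps N. \<forall>x\<in>U \<inter> Omega n. \<forall>s.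
       \<bar>s - t\<bar> < \<delta> \<longrightarrow> (F x ^^ N) s \<in> {g s, h s}"
    using uniformly_captures[OF x\<^sub>0] by metis
  obtain M :: nat and C where C: "\<And>m. finite (C m)" "\<And>m. card (C m) \<le> M * 2 ^ m"
    "\<And>m x. x \<in> U \<inter> Omega n \<Longrightarrow>
       (F x ^^ (N * m + 1)) ` I \<subseteq> (\<Union>c\<in>C m. cball c ((\<rho> ^ N) ^ m * (\<delta> / 2)))"
    by (rule iterates_covered[OF \<open>N \<ge> 1\<close> U(3) Int_lower2 U(4)]) blast+
  define Z where "Z m = (\<Union>c\<in>C m. cball c ((\<rho> ^ N) ^ m * (\<delta> / 2)))" for m
  have closedZ: "closed (Z m)" for m unfolding Z_def using C(1) by (intro closed_UN) auto
  have "emeasure lborel (\<Inter>m. Z m) \<le> ennreal ((2 * \<rho> ^ N) ^ m * (M * \<delta>))" for m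
  proof -
    have "emeasure lborel (\<Inter>m. Z m) \<le> emeasure lborel (Z m)"
      using closedZ by (intro emeasure_mono) auto
    also have "\<dots> \<le> ennreal (real (M * 2 ^ m) * (2 * ((\<rho> ^ N) ^ m * (\<delta> / 2))))"
      unfolding Z_def using C U(3) rho by (intro emeasure_Union_cball_le) auto
    also have "real (M * 2 ^ m) * (2 * ((\<rho> ^ N) ^ m * (\<delta> / 2))) = (2 * \<rho> ^ N) ^ m * (M * \<delta>)"
      by (simp add: power_mult_distrib)
    finally show ?thesis .
  qed
  moreover have "(\<lambda>m. ennreal ((2 * \<rho> ^ N) ^ m * (M * \<delta>))) \<longlonglongrightarrow> ennreal (0 * (M * \<delta>))"
    using N rho by (intro tendsto_ennrealI tendsto_mult_right LIMSEQ_realpow_zero) auto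
  ultimately have "emeasure lborel (\<Inter>m. Z m) \<le> ennreal (0 * (M * \<delta>))"
    by (intro LIMSEQ_le_const) auto
  then have "emeasure lborel (\<Inter>m. Z m) = 0" by simp
  then have null: "(\<Inter>m. Z m) \<in> null_sets lborel"
    by (rule null_setsI) (simp add: borel_closed closed_INT closedZ)
  show ?thesis
  proof (rule that[OF U(1,2) null], intro ballI impI)
    fix x assume "x \<in> U \<inter> Omega n" and off: "\<forall>i\<in>{1..<n}. x i \<notin> (\<Inter>m. Z m)"
    then have x: "x \<in> U" "x \<in> Omega n" by auto
    show "asymptotically_periodic (F x)"
    proof (rule asymptotically_periodic_if_avoiding[OF x(2)])
      fix i assume "i \<in> {1..<n}"
      then obtain m where m: "x i \<notin> Z m" using off by blast
      have "closure ((F x ^^ (N * m + 1)) ` I) \<subseteq> Z m"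
        using C(3)[of x m] x closedZ by (intro closure_minimal) (auto simp: Z_def)
      then show "\<exists>K. x i \<notin> closure ((F x ^^ K) ` I)" using m by blast
    qed
  qed
qed

text \<open>The good open sets have a countable subfamily with the same union, so the null sets of
  its members can be discarded together. Every generic \<open>x\<close> in \<open>Omega n\<close>
  lies in that union.\<close>

lemma AE_asymptotically_periodic:
  "AE x in PiM {1..<n} (\<lambda>_. lborel). x \<in> Omega n \<longrightarrow> asymptotically_periodic (F x)"
proof -
  define good where "good U Z \<longleftrightarrow> open U \<and> Z \<in> null_sets lborel \<and>
    (\<forall>x\<in>U \<inter> Omega n. (\<forall>i\<in>{1..<n}. x i \<notin> Z) \<longrightarrow> asymptotically_periodic (F x))" for U Z
  obtain \<U> where \<U>: "\<U> \<subseteq> {U. \<exists>Z. good U Z}" "countable \<U>" "\<Union>\<U> = \<Union>{U. \<exists>Z. good U Z}"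
    by (rule Lindelof[of "{U. \<exists>Z. good U Z}"]) (auto simp: good_def)
  have "\<forall>U\<in>\<U>. \<exists>Z. good U Z" using \<U>(1) by blast
  from bchoice[OF this] obtain Z where Z: "\<And>U. U \<in> \<U> \<Longrightarrow> good U (Z U)" by blast
  have "AE x in PiM {1..<n} (\<lambda>_. lborel). \<forall>U\<in>\<U>. \<forall>i\<in>{1..<n}. x i \<notin> Z U"
    unfolding AE_ball_countable[OF \<U>(2)] AE_ball_countable[OF countable_finite[OF finite_atLeastLessThan]]
  proof (intro ballI AE_PiM_lborel_coordinate AE_not_in)
    show "Z U \<in> null_sets lborel" if "U \<in> \<U>" for U using Z[OF that] by (simp add: good_def)
  qed auto
  with AE_generic show ?thesis
  proof eventually_elim
    case (elim x)
    show ?case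
    proof
      assume x: "x \<in> Omega n"
      obtain U Z' where U: "open U" "x \<in> U" "Z' \<in> null_sets lborel"
        "\<forall>y\<in>U \<inter> Omega n. (\<forall>i\<in>{1..<n}. y i \<notin> Z') \<longrightarrow> asymptotically_periodic (F y)"
        by (rule asymptotically_periodic_near_generic[OF x elim(1)])
      then have "good U Z'" unfolding good_def by blast
      \<comment> \<open>The neighbourhood found need not belong to \<open>\<U>\<close>; some member
        \<open>U'\<close>, whose own null set has been discarded, contains \<open>x\<close>.\<close>
      then have "x \<in> \<Union>\<U>" unfolding \<U>(3) using U(2) by blast
      then obtain U' where "U' \<in> \<U>" "x \<in> U'" by blast
      then show "asymptotically_periodic (F x)" using Z[of U'] x elim(2) by (auto simp: good_def)
    qed
  qed
qed

end

section \<open>Branches given on the unit interval only\<close>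

lemma asymptotically_periodic_cong:
  assumes "\<And>t. t \<in> {0..<1} \<Longrightarrow> f t = g t" "\<And>t. t \<in> {0..<1} \<Longrightarrow> g t \<in> {0..<1}"
  shows "periodic_orbit f = periodic_orbit g" "asymptotically_periodic f = asymptotically_periodic g"
proof -
  have eq: "(f ^^ j) t = (g ^^ j) t" if "t \<in> {0..<1}" for j t
    using funpow_cong_unit_interval[of f g, OF assms that] .
  show *: "periodic_orbit f = periodic_orbit g"
    unfolding periodic_orbit_def by (intro ext bex_cong) (simp_all add: eq)
  show "asymptotically_periodic f = asymptotically_periodic g"
    unfolding asymptotically_periodic_def * omega_limit_def by (intro ball_cong) (simp_all add: eq)
qed

theorem theorem1p1:
  fixes n :: nat and \<phi> :: "nat \<Rightarrow> real \<Rightarrow> real"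
  assumes "n \<ge> 2"
    and "\<And>i. i \<in> {1..n} \<Longrightarrow> \<phi> i \<in> {0..1} \<rightarrow> {0<..<1}"
    and "\<And>i. i \<in> {1..n} \<Longrightarrow> lipschitz_contraction_on {0..1} (\<phi> i)"
  shows "AE x in completion (\<Pi>\<^sub>M i\<in>{1..<n}. lborel). x \<in> Omega n \<longrightarrow>
           asymptotically_periodic (pc_map n \<phi> x) \<and>
           finite {S. periodic_orbit (pc_map n \<phi> x) S} \<and>
           1 \<le> card {S. periodic_orbit (pc_map n \<phi> x) S} \<and>
           card {S. periodic_orbit (pc_map n \<phi> x) S} \<le> n"
proof -
  obtain L where L: "\<And>i. i \<in> {1..n} \<Longrightarrow> L i < 1 \<and> (L i)-lipschitz_on {0..1} (\<phi> i)"
    using assms(3) unfolding lipschitz_contraction_on_def by metis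
  define \<rho> where "\<rho> = Max (insert 0 (L ` {1..n}))"
  have "0 \<le> \<rho>" "\<rho> < 1" using L by (auto simp: \<rho>_def)
  moreover have "L i \<le> \<rho>" if "i \<in> {1..n}" for i unfolding \<rho>_def using that by (intro Max_ge) auto
  ultimately have rho: "0 \<le> \<rho>" "\<rho> < 1" "\<And>i. i \<in> {1..n} \<Longrightarrow> L i \<le> \<rho>" by blast+
  \<comment> \<open>The images form a compact subset of (0,1); its least and greatest points serve
    as \<alpha> and \<beta>.\<close>
  define K where "K = (\<Union>i\<in>{1..n}. \<phi> i ` {0..1})"
  have "compact K" unfolding K_def
    using L by (intro compact_UN compact_continuous_image) (auto intro: lipschitz_on_continuous_on)
  moreover have "\<phi> 1 0 \<in> K" unfolding K_def using assms(1) by (intro UN_I[of 1] imageI) auto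
  then have "K \<noteq> {}" by (rule ex_in_conv[THEN iffD1, OF exI])
  ultimately obtain \<alpha> \<beta> where ab: "\<alpha> \<in> K" "\<beta> \<in> K" "\<And>y. y \<in> K \<Longrightarrow> \<alpha> \<le> y \<and> y \<le> \<beta>"
    using compact_attains_inf compact_attains_sup by metis
  have K: "K \<subseteq> {0<..<1}" using assms(2) unfolding K_def by blast
  \<comment> \<open>Clamping retracts the line onto [0,1] without increasing distances, so it
    extends the branches with the same Lipschitz constants.\<close>
  define clamp :: "real \<Rightarrow> real" where "clamp t = max 0 (min 1 t)" for t
  have clamp: "clamp t \<in> {0..1}" "\<bar>clamp s - clamp t\<bar> \<le> \<bar>s - t\<bar>" for s t
    by (auto simp: clamp_def)
  define \<psi> where "\<psi> i t = \<phi> i (clamp t)" for i t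
  interpret contraction_family n \<psi> \<rho> \<alpha> \<beta>
  proof
    fix i s t assume i: "i \<in> {1..n}"
    have "\<bar>\<psi> i s - \<psi> i t\<bar> \<le> L i * \<bar>clamp s - clamp t\<bar>"
      using lipschitz_onD[of "L i" "{0..1}" "\<phi> i" "clamp s" "clamp t"] L[OF i] clamp(1)
      by (simp add: \<psi>_def dist_real_def)
    also have "\<dots> \<le> \<rho> * \<bar>s - t\<bar>" using rho i clamp(2) by (intro mult_mono) auto
    finally show "\<bar>\<psi> i s - \<psi> i t\<bar> \<le> \<rho> * \<bar>s - t\<bar>" .
    have "\<psi> i t \<in> K" unfolding K_def \<psi>_def using clamp(1) by (intro UN_I[OF i] imageI)
    then show "\<psi> i t \<in> {\<alpha>..\<beta>}" using ab(3) by auto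
  qed (use assms(1) rho ab K in auto)
  have "periodic_orbit (pc_map n \<phi> x) = periodic_orbit (F x)"
      "asymptotically_periodic (pc_map n \<phi> x) = asymptotically_periodic (F x)"
    if "x \<in> Omega n" for x
  proof -
    have "pc_map n \<phi> x t = F x t" if "t \<in> {0..<1}" for t
      using that by (simp add: pc_map_def \<psi>_def clamp_def)
    note asymptotically_periodic_cong[of "pc_map n \<phi> x" "F x", OF this F_in_unit_interval[OF that]]
    then show "periodic_orbit (pc_map n \<phi> x) = periodic_orbit (F x)"
      "asymptotically_periodic (pc_map n \<phi> x) = asymptotically_periodic (F x)" by blast+
  qed
  \<comment> \<open>A null set of the product of Borel measures remains null in the
    completion.\<close>
  moreover have "AE x in completion (\<Pi>\<^sub>M i\<in>{1..<n}. lborel). x \<in> Omega n \<longrightarrow> asymptotically_periodic (F x)"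
    by (rule AE_completion[OF AE_asymptotically_periodic])
  ultimately show ?thesis
    using finitely_many_periodic_orbits by (auto elim!: eventually_mono)
qed

end
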